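(* Assume that $K \ge 2N+6$. Let $(W_0,Y_0),(W_1,Y_1)\in\mathcal U^N_K$. Then there exists a continuous map $\psi:[0,1]\to\mathcal U^N_K$ made of a polygonal chain (i.e. continuous and piecewise affine with finitely many pieces) such that $\psi(0)=(W_0,Y_0)$, $\psi(1)=(W_1,Y_1)$, and such that the map $[0,1]\ni t\mapsto \mathcal I(\psi(t))$ is monotone.
   Context: Setting. Let $d,M,N,K$ be positive integers, let $\mu$ be a Borel probability measure on $\mathbb R^d$, and let $c:(\mathbb R^d)^M\to\mathbb R_+\cup\{+\infty\}$ be lower semi-continuous and symmetric, i.e. $c(x_1,\dots,x_M)=c(x_{\sigma(1)},\dots,x_{\sigma(M)})$ for every permutation $\sigma$ of $\{1,\dots,M\}$. Let $\phi_1,\dots,\phi_N:\mathbb R^d\to\mathbb R$ be continuous functions, integrable with respect to $\mu$ (test functions), and put $\mu_n=\int_{\mathbb R^d}\phi_n\,d\mu$ for $1\le n\le N$. Let $\theta:\mathbb R_+\to\mathbb R_+$ be a non-decreasing continuous function with $\theta(r)\to+\infty$ as $r\to+\infty$, such that there exist $C>0$ and $0<s<1$ with $|\phi_n(x)|\le C(1+\theta(|x|))^s$ for all $1\le n\le N$ and $x\in\mathbb R^d$. Let $A>0$ be a real number with $A\ge A_0:=\int_{\mathbb R^d}\theta(|x|)\,d\mu(x)$. For $X=(x_1,\dots,x_M)\in(\mathbb R^d)^M$ set $\vartheta(X)=\frac1M\sum_{m=1}^M\theta(|x_m|)$ and $\varphi_n(X)=\frac1M\sum_{m=1}^M\phi_n(x_m)$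 for $1\le n\le N$. The admissible set $\mathcal U^N_K$ is the set of all $(W,Y)\in\mathbb R_+^K\times((\mathbb R^d)^M)^K$, with $W=(w_k)_{1\le k\le K}$ and $Y=(X^k)_{1\le k\le K}$, such that $$\sum_{k=1}^K w_k=1,\qquad \sum_{k=1}^K w_k\vartheta(X^k)\le A,\qquad \sum_{k=1}^K w_k\varphi_n(X^k)=\mu_n\ \text{ for all }1\le n\le N.$$ The cost of $(W,Y)\in\mathbb R_+^K\times((\mathbb R^d)^M)^K$ is $\mathcal I(W,Y)=\sum_{k=1}^K w_k\,c(X^k)\in[0,+\infty]$, with the convention $0\cdot(+\infty)=0$. Here $\mathbb R_+=[0,\infty)$; monotone means non-decreasing or non-increasing (not necessarily strictly), with values in $[0,+\infty]$. *)

theory Defs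
  imports "HOL-Probability.Probability"
begin

definition lsc :: "('a::topological_space \<Rightarrow> ennreal) \<Rightarrow> bool" where
  "lsc f \<longleftrightarrow> (\<forall>x. f x \<le> Liminf (at x) f)"

definition symmetric_cost :: "('a ^ 'm \<Rightarrow> ennreal) \<Rightarrow> bool" where
  "symmetric_cost c \<longleftrightarrow> (\<forall>\<sigma>. \<sigma> permutes UNIV \<longrightarrow> (\<forall>X. c (\<chi> m. X $ \<sigma> m) = c X))"

definition coord_avg :: "('a \<Rightarrow> real) \<Rightarrow> 'a ^ 'm \<Rightarrow> real" where
  "coord_avg f X = (\<Sum>m\<in>UNIV. f (X $ m)) / real CARD('m)"

text \<open>The numbers d, M, N, K are the cardinalities of the finite index types
  \<open>'d\<close>, \<open>'m\<close>, \<open>'n\<close>, \<open>'k\<close>; all of them are positive because types are nonempty.\<close>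

definition admissible ::
  "(real ^ 'd) measure \<Rightarrow> ('n::finite \<Rightarrow> real ^ 'd \<Rightarrow> real) \<Rightarrow> (real \<Rightarrow> real) \<Rightarrow> real \<Rightarrow>
    ((real ^ 'k) \<times> (((real ^ 'd) ^ 'm) ^ 'k)) set" where
  "admissible \<mu> \<phi> \<theta> A = {(W, Y).
     (\<forall>k. 0 \<le> W $ k) \<and>
     (\<Sum>k\<in>UNIV. W $ k) = 1 \<and>
     (\<Sum>k\<in>UNIV. W $ k * coord_avg (\<lambda>x. \<theta> (norm x)) (Y $ k)) \<le> A \<and>
     (\<forall>n. (\<Sum>k\<in>UNIV. W $ k * coord_avg (\<phi> n) (Y $ k)) = (\<integral>x. \<phi> n x \<partial>\<mu>))}"

text \<open>In \<open>ennreal\<close> one has \<open>0 * \<infinity> = 0\<close>. The value is meaningful only for nonnegative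
  weights, since \<open>ennreal\<close> sends negative reals to 0.\<close>

definition total_cost ::
  "((real ^ 'd) ^ 'm \<Rightarrow> ennreal) \<Rightarrow> (real ^ 'k) \<times> (((real ^ 'd) ^ 'm) ^ 'k) \<Rightarrow> ennreal" where
  "total_cost c = (\<lambda>(W, Y). \<Sum>k\<in>UNIV. ennreal (W $ k) * c (Y $ k))"

definition polygonal_chain :: "(real \<Rightarrow> 'a::real_normed_vector) \<Rightarrow> bool" where
  "polygonal_chain \<psi> \<longleftrightarrow>
     continuous_on {0..1} \<psi> \<and>
     (\<exists>(r::nat) (p :: nat \<Rightarrow> real). p 0 = 0 \<and> p r = 1 \<and> (\<forall>i<r. p i < p (Suc i)) \<and>
        (\<forall>i<r. \<exists>a b. \<forall>t\<in>{p i..p (Suc i)}. \<psi> t = a + t *\<^sub>R b))"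

end

theory Submission
  imports Defs
begin

text \<open>
  Two kinds of straight moves stay in the admissible set and keep the cost under control.
  With the positions \<open>Y\<close> fixed, all constraints and the cost are affine in the weights \<open>W\<close>, so
  the segment between two admissible weight vectors is admissible and the cost along it goes
  monotonically from one end value to the other (\<open>ascends_change_weights\<close>). With the weights fixed,
  the atoms of weight zero may be moved anywhere, and neither the constraints nor the cost notice
  (\<open>ascends_move_unused_points\<close>).

  By Caratheodory's theorem the weights of any admissible configuration can be concentrated on at
  most \<open>N + 3\<close> atoms without changing the \<open>N\<close> moments, the \<open>\<theta>\<close>-moment, the total mass and the
  cost (\<open>admissible_sparse_weights\<close>). This costs one segment of constant cost at either end, and then two
  supports of size at most \<open>N + 3\<close> fit side by side into \<open>K \<ge> 2 N + 6\<close> slots. Suppose that the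
  supports are disjoint. The slots that are unused by the first configuration may then receive the
  atoms of the second one, and a single segment transports all the mass from the first
  configuration to the second; this is the only segment on which the cost changes. If the supports
  overlap, the atoms of the second configuration in the common slots are first sent to
  slots that neither of the two uses. Afterwards their old slots are
  free, so they can be filled with copies of these atoms, and the mass is shifted back at constant
  cost (\<open>ascends_sparse\<close>).

  Everything is stated for chains along which the cost does not decrease. The chain in the other
  direction is obtained by reversing time, so it suffices to start from the cheaper of the two
  configurations.
\<close>

section \<open>Polygonal chains along which a function increases\<close>

definition ascends :: "('a::real_normed_vector \<Rightarrow> ennreal) \<Rightarrow> 'a set \<Rightarrow> 'a \<Rightarrow> 'a \<Rightarrow> bool" where
  "ascends f U x y \<longleftrightarrow> (\<exists>\<psi>. \<psi> ` {0..1} \<subseteq> U \<and> polygonal_chain \<psi> \<and> \<psi> 0 = x \<and> \<psi> 1 = y \<and>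
     mono_on {0..1} (\<lambda>t. f (\<psi> t)))"

lemma ascends_segment:
  assumes U: "\<And>t. \<lbrakk>0 \<le> t; t \<le> 1\<rbrakk> \<Longrightarrow> (1 - t) *\<^sub>R x + t *\<^sub>R y \<in> U"
    and mono: "mono_on {0..1} (\<lambda>t. f ((1 - t) *\<^sub>R x + t *\<^sub>R y))"
  shows "ascends f U x y"
proof -
  have "polygonal_chain (\<lambda>t. (1 - t) *\<^sub>R x + t *\<^sub>R y)"
    unfolding polygonal_chain_def
  proof (intro conjI)
    show "continuous_on {0..1} (\<lambda>t. (1 - t) *\<^sub>R x + t *\<^sub>R y)"
      by (intro continuous_intros)
    have "\<exists>a b. \<forall>t\<in>{0..1::real}. (1 - t) *\<^sub>R x + t *\<^sub>R y = a + t *\<^sub>R b"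
      by (rule exI[of _ x], rule exI[of _ "y - x"]) (simp add: algebra_simps)
    then show "\<exists>(r::nat) (p :: nat \<Rightarrow> real). p 0 = 0 \<and> p r = 1 \<and> (\<forall>i<r. p i < p (Suc i)) \<and>
        (\<forall>i<r. \<exists>a b. \<forall>t\<in>{p i..p (Suc i)}. (1 - t) *\<^sub>R x + t *\<^sub>R y = a + t *\<^sub>R b)"
      by (intro exI[of _ "1::nat"] exI[of _ real]) simp
  qed
  then show ?thesis
    unfolding ascends_def using U mono
    by (intro exI[of _ "\<lambda>t. (1 - t) *\<^sub>R x + t *\<^sub>R y"]) auto
qed

lemma polygonal_chain_join:
  assumes "polygonal_chain g" "polygonal_chain h" and gh: "g 1 = h 0"
  shows "polygonal_chain (g +++ h)"
proof -
  obtain r p where p: "p 0 = 0" "p r = 1" "\<And>i. i < r \<Longrightarrow> p i < p (Suc i)"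
    and gp: "\<And>i. i < r \<Longrightarrow> \<exists>a b. \<forall>t\<in>{p i..p (Suc i)}. g t = a + t *\<^sub>R b"
    and gc: "continuous_on {0..1} g"
    using assms(1) unfolding polygonal_chain_def by blast
  obtain s q where q: "q 0 = 0" "q s = 1" "\<And>i. i < s \<Longrightarrow> q i < q (Suc i)"
    and hq: "\<And>i. i < s \<Longrightarrow> \<exists>a b. \<forall>t\<in>{q i..q (Suc i)}. h t = a + t *\<^sub>R b"
    and hc: "continuous_on {0..1} h"
    using assms(2) unfolding polygonal_chain_def by blast
  have p_le: "p i \<le> 1" if "i \<le> r" for i
    using that
  proof (induction rule: inc_induct)
    case base
    then show ?case using p by simp
  next
    case (step n)
    then show ?case using p(3)[of n] by simp
  qed
  have q_ge: "0 \<le> q i" if "i \<le> s" for i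
    using that
  proof (induction i)
    case 0
    then show ?case using q by simp
  next
    case (Suc n)
    then show ?case using q(3)[of n] by simp
  qed
  \<comment> \<open>The breakpoints of \<open>g\<close>, squeezed into the first half of the unit interval, followed by those
    of \<open>h\<close> in the second half; the common breakpoint \<open>1/2\<close> has index \<open>r\<close>.\<close>
  define b where "b i = (if i \<le> r then p i / 2 else (1 + q (i - r)) / 2)" for i
  have b_late: "b (r + j) = (1 + q j) / 2" for j
    using p q by (cases j) (auto simp: b_def)
  have b_early: "b i = p i / 2" if "i \<le> r" for i
    using that by (simp add: b_def)
  have piece: "b i < b (Suc i) \<and> (\<exists>u v. \<forall>t\<in>{b i..b (Suc i)}. (g +++ h) t = u + t *\<^sub>R v)"
    if i: "i < r + s" for i
  proof (cases "i < r")
    case True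
    then obtain u v where uv: "\<And>t. t \<in> {p i..p (Suc i)} \<Longrightarrow> g t = u + t *\<^sub>R v"
      using gp by blast
    have "(g +++ h) t = u + t *\<^sub>R (2 *\<^sub>R v)" if "t \<in> {b i..b (Suc i)}" for t
      using that True uv[of "2 * t"] p_le[of "Suc i"]
      by (auto simp: b_early joinpaths_def mult.commute)
    then have "\<exists>u v. \<forall>t\<in>{b i..b (Suc i)}. (g +++ h) t = u + t *\<^sub>R v"
      by blast
    then show ?thesis
      using True p(3)[of i] by (simp add: b_early)
  next
    case False
    then obtain j where j: "i = r + j" "j < s"
      using i by (metis add_less_cancel_left le_Suc_ex not_less)
    then obtain u v where uv: "\<And>t. t \<in> {q j..q (Suc j)} \<Longrightarrow> h t = u + t *\<^sub>R v"
      using hq by blast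
    have "(g +++ h) t = (u - v) + t *\<^sub>R (2 *\<^sub>R v)" if t: "t \<in> {b i..b (Suc i)}" for t
    proof -
      have t': "2 * t - 1 \<in> {q j..q (Suc j)}"
        using t b_late[of j] b_late[of "Suc j"] j by (auto simp: field_simps)
      then have "t \<ge> 1/2"
        using q_ge[of j] j by simp
      moreover have "(g +++ h) (1/2) = h (2 * (1/2) - 1)"
        using gh by (simp add: joinpaths_def)
      moreover have "(g +++ h) t = h (2 * t - 1)" if "t > 1/2"
        using that by (simp add: joinpaths_def)
      ultimately have "(g +++ h) t = h (2 * t - 1)"
        by (metis order_le_less)
      also have "\<dots> = (u - v) + t *\<^sub>R (2 *\<^sub>R v)"
        using uv[OF t'] by (simp add: algebra_simps)
      finally show ?thesis .
    qed
    then have "\<exists>u v. \<forall>t\<in>{b i..b (Suc i)}. (g +++ h) t = u + t *\<^sub>R v"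
      by blast
    moreover have "b i < b (Suc i)"
      using j(1) q(3)[OF j(2)] b_late[of j] b_late[of "Suc j"] by simp
    ultimately show ?thesis by blast
  qed
  have "continuous_on {0..1} (g +++ h)"
    using gc hc gh path_join[of g h] unfolding path_def pathfinish_def pathstart_def by simp
  moreover have "b 0 = 0" "b (r + s) = 1"
    using p q b_late[of s] by (auto simp: b_def)
  ultimately show ?thesis
    unfolding polygonal_chain_def using piece by blast
qed

lemma polygonal_chain_reverse:
  assumes "polygonal_chain g"
  shows "polygonal_chain (reversepath g)"
proof -
  obtain r p where p: "p 0 = 0" "p r = 1" "\<And>i. i < r \<Longrightarrow> p i < p (Suc i)"
    and gp: "\<And>i. i < r \<Longrightarrow> \<exists>a b. \<forall>t\<in>{p i..p (Suc i)}. g t = a + t *\<^sub>R b"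
    and gc: "continuous_on {0..1} g"
    using assms unfolding polygonal_chain_def by blast
  define q where "q i = 1 - p (r - i)" for i
  have piece: "q i < q (Suc i) \<and> (\<exists>u v. \<forall>t\<in>{q i..q (Suc i)}. reversepath g t = u + t *\<^sub>R v)"
    if i: "i < r" for i
  proof -
    define j where "j = r - Suc i"
    have j: "j < r" "r - i = Suc j" "r - Suc i = j"
      using i by (auto simp: j_def)
    then obtain u v where uv: "\<And>t. t \<in> {p j..p (Suc j)} \<Longrightarrow> g t = u + t *\<^sub>R v"
      using gp by blast
    have "reversepath g t = (u + v) + t *\<^sub>R (- v)" if "t \<in> {q i..q (Suc i)}" for t
      using that uv[of "1 - t"] j by (auto simp: q_def reversepath_def algebra_simps)
    then have "\<exists>u v. \<forall>t\<in>{q i..q (Suc i)}. reversepath g t = u + t *\<^sub>R v"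
      by blast
    then show ?thesis
      using p(3)[of j] j by (simp add: q_def)
  qed
  have "continuous_on {0..1} (reversepath g)"
    using gc path_reversepath[of g] unfolding path_def by simp
  moreover have "q 0 = 0" "q r = 1"
    using p by (auto simp: q_def)
  ultimately show ?thesis
    unfolding polygonal_chain_def using piece by blast
qed

lemma ascends_trans [trans]:
  assumes "ascends f U x y" "ascends f U y z"
  shows "ascends f U x z"
proof -
  obtain g where g: "g ` {0..1} \<subseteq> U" "polygonal_chain g" "g 0 = x" "g 1 = y"
      "mono_on {0..1} (\<lambda>t. f (g t))"
    using assms(1) unfolding ascends_def by blast
  obtain h where h: "h ` {0..1} \<subseteq> U" "polygonal_chain h" "h 0 = y" "h 1 = z"
      "mono_on {0..1} (\<lambda>t. f (h t))"
    using assms(2) unfolding ascends_def by blast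
  have gm: "f (g s) \<le> f (g t)" if "0 \<le> s" "s \<le> t" "t \<le> 1" for s t
    using mono_onD[OF g(5), of s t] that by simp
  have hm: "f (h s) \<le> f (h t)" if "0 \<le> s" "s \<le> t" "t \<le> 1" for s t
    using mono_onD[OF h(5), of s t] that by simp
  have mono: "mono_on {0..1} (\<lambda>t. f ((g +++ h) t))"
  proof (rule mono_onI)
    fix s t :: real
    assume st: "s \<in> {0..1}" "t \<in> {0..1}" "s \<le> t"
    consider "t \<le> 1/2" | "s \<le> 1/2" "t > 1/2" | "s > 1/2" by linarith
    then show "f ((g +++ h) s) \<le> f ((g +++ h) t)"
    proof cases
      case 1
      then show ?thesis using st by (auto simp: joinpaths_def intro!: gm)
    next
      case 2
      have "f (g (2 * s)) \<le> f (g 1)"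
        using 2 st by (intro gm) auto
      also have "\<dots> \<le> f (h (2 * t - 1))"
        using 2 st hm[of 0 "2 * t - 1"] g h by simp
      finally show ?thesis using 2 by (simp add: joinpaths_def)
    next
      case 3
      then show ?thesis using st by (auto simp: joinpaths_def intro!: hm)
    qed
  qed
  have "g (2 * t) \<in> U" if "0 \<le> t" "t \<le> 1/2" for t
    using g(1) that by (auto simp: image_subset_iff)
  moreover have "h (2 * t - 1) \<in> U" if "1/2 < t" "t \<le> 1" for t
    using h(1) that by (auto simp: image_subset_iff)
  ultimately have "(g +++ h) ` {0..1} \<subseteq> U"
    by (auto simp: joinpaths_def not_le)
  moreover have "polygonal_chain (g +++ h)"
    using g h by (intro polygonal_chain_join) auto
  moreover have "(g +++ h) 0 = x" "(g +++ h) 1 = z"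
    using g h by (auto simp: joinpaths_def)
  ultimately show ?thesis
    using mono unfolding ascends_def by blast
qed

lemma ascends_reverse:
  assumes "ascends f U x y"
  shows "\<exists>\<psi>. \<psi> ` {0..1} \<subseteq> U \<and> polygonal_chain \<psi> \<and> \<psi> 0 = y \<and> \<psi> 1 = x \<and>
    antimono_on {0..1} (\<lambda>t. f (\<psi> t))"
proof -
  obtain g where g: "g ` {0..1} \<subseteq> U" "polygonal_chain g" "g 0 = x" "g 1 = y"
      "mono_on {0..1} (\<lambda>t. f (g t))"
    using assms(1) unfolding ascends_def by blast
  have "antimono_on {0..1} (\<lambda>t. f (reversepath g t))"
    using g(5) by (auto simp: monotone_on_def reversepath_def)
  moreover have "reversepath g ` {0..1} \<subseteq> U"
    using g(1) by (auto simp: reversepath_def image_subset_iff)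
  ultimately show ?thesis
    using g polygonal_chain_reverse[OF g(2)]
    by (intro exI[of _ "reversepath g"]) (auto simp: reversepath_def)
qed

section \<open>The two elementary moves\<close>

lemma total_cost_eq_on_support:
  assumes "\<And>k. W $ k \<noteq> 0 \<Longrightarrow> Y $ k = Y' $ k"
  shows "total_cost c (W, Y) = total_cost c (W, Y')"
  unfolding total_cost_def prod.case
proof (intro sum.cong refl)
  fix k
  show "ennreal (W $ k) * c (Y $ k) = ennreal (W $ k) * c (Y' $ k)"
    using assms[of k] by (cases "W $ k = 0") auto
qed

lemma admissible_eq_on_support:
  assumes "\<And>k. W $ k \<noteq> 0 \<Longrightarrow> Y $ k = Y' $ k"
  shows "(W, Y) \<in> admissible \<mu> \<phi> \<theta> A \<longleftrightarrow> (W, Y') \<in> admissible \<mu> \<phi> \<theta> A"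
proof -
  have "(\<Sum>k\<in>UNIV. W $ k * F (Y $ k)) = (\<Sum>k\<in>UNIV. W $ k * F (Y' $ k))" for F
  proof (intro sum.cong refl)
    fix k
    show "W $ k * F (Y $ k) = W $ k * F (Y' $ k)"
      using assms[of k] by (cases "W $ k = 0") auto
  qed
  then show ?thesis
    unfolding admissible_def by simp
qed

text \<open>The weights have to be nonnegative because \<open>ennreal\<close> is additive only there. Infinite costs
  are included: \<open>0 * \<infinity> = 0\<close> makes the formula correct at both ends of the segment.\<close>

lemma total_cost_affine_in_weights:
  assumes "\<And>k. 0 \<le> V $ k" "\<And>k. 0 \<le> W $ k" "0 \<le> t" "t \<le> 1"
  shows "total_cost c ((1 - t) *\<^sub>R V + t *\<^sub>R W, Y)
    = ennreal (1 - t) * total_cost c (V, Y) + ennreal t * total_cost c (W, Y)"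
proof -
  have "ennreal (((1 - t) *\<^sub>R V + t *\<^sub>R W) $ k)
      = ennreal (1 - t) * ennreal (V $ k) + ennreal t * ennreal (W $ k)" for k
    using assms by (simp add: ennreal_plus ennreal_mult)
  then show ?thesis
    by (simp only: total_cost_def prod.case distrib_right sum.distrib sum_distrib_left mult.assoc)
qed

lemma admissible_convex_in_weights:
  assumes V: "(V, Y) \<in> admissible \<mu> \<phi> \<theta> A" and W: "(W, Y) \<in> admissible \<mu> \<phi> \<theta> A"
    and t: "0 \<le> t" "t \<le> 1"
  shows "((1 - t) *\<^sub>R V + t *\<^sub>R W, Y) \<in> admissible \<mu> \<phi> \<theta> A"
proof -
  have lin: "(\<Sum>k\<in>UNIV. ((1 - t) * V $ k + t * W $ k) * F k)
      = (1 - t) * (\<Sum>k\<in>UNIV. V $ k * F k) + t * (\<Sum>k\<in>UNIV. W $ k * F k)" for F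
    by (simp add: sum_distrib_left sum.distrib distrib_right mult.assoc)
  have "(1 - t) * (\<Sum>k\<in>UNIV. V $ k * coord_avg (\<lambda>x. \<theta> (norm x)) (Y $ k))
      + t * (\<Sum>k\<in>UNIV. W $ k * coord_avg (\<lambda>x. \<theta> (norm x)) (Y $ k)) \<le> A"
    using V W t by (intro convex_bound_le) (auto simp: admissible_def)
  moreover have "(1 - t) * (\<Sum>k\<in>UNIV. V $ k) + t * (\<Sum>k\<in>UNIV. W $ k) = 1"
    using V W by (simp add: admissible_def)
  moreover have "(1 - t) * (\<Sum>k\<in>UNIV. V $ k * coord_avg (\<phi> n) (Y $ k))
      + t * (\<Sum>k\<in>UNIV. W $ k * coord_avg (\<phi> n) (Y $ k)) = (\<integral>x. \<phi> n x \<partial>\<mu>)" for n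
    using V W by (simp add: admissible_def algebra_simps)
  ultimately show ?thesis
    using V W t lin[of "\<lambda>k. 1"] unfolding admissible_def prod.case mem_Collect_eq
    by (auto simp: lin simp del: ring_distribs)
qed

text \<open>The end values may be infinite. If \<open>a < b = \<infinity>\<close>, the function jumps from \<open>a\<close> to \<open>\<infinity>\<close> right after
  \<open>t = 0\<close>, which is still monotone.\<close>

lemma mono_on_ennreal_segment:
  fixes a b :: ennreal
  assumes "a \<le> b"
  shows "mono_on {0..1} (\<lambda>t. ennreal (1 - t) * a + ennreal t * b)"
proof (rule mono_onI)
  fix s t :: real
  assume st: "s \<in> {0..1}" "t \<in> {0..1}" "s \<le> t"
  \<comment> \<open>The mass \<open>t - s\<close> is moved from \<open>a\<close> to \<open>b\<close>; no subtraction in \<open>ennreal\<close> occurs.\<close>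
  have "ennreal (1 - s) * a + ennreal s * b
      = ennreal (1 - t) * a + ennreal (t - s) * a + ennreal s * b"
    using st by (simp flip: distrib_right ennreal_plus)
  also have "\<dots> \<le> ennreal (1 - t) * a + ennreal (t - s) * b + ennreal s * b"
    using assms by (intro add_mono mult_left_mono) auto
  also have "\<dots> = ennreal (1 - t) * a + ennreal t * b"
    using st by (simp add: add.assoc flip: distrib_right ennreal_plus)
  finally show "ennreal (1 - s) * a + ennreal s * b \<le> ennreal (1 - t) * a + ennreal t * b" .
qed

lemma ascends_change_weights:
  assumes V: "(V, Y) \<in> admissible \<mu> \<phi> \<theta> A" and W: "(W, Y) \<in> admissible \<mu> \<phi> \<theta> A"
    and le: "total_cost c (V, Y) \<le> total_cost c (W, Y)"
  shows "ascends (total_cost c) (admissible \<mu> \<phi> \<theta> A) (V, Y) (W, Y)"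
proof (rule ascends_segment)
  have seg: "(1 - t) *\<^sub>R (V, Y) + t *\<^sub>R (W, Y) = ((1 - t) *\<^sub>R V + t *\<^sub>R W, Y)" for t :: real
    by (simp add: prod_eq_iff flip: scaleR_add_left)
  show "(1 - t) *\<^sub>R (V, Y) + t *\<^sub>R (W, Y) \<in> admissible \<mu> \<phi> \<theta> A" if "0 \<le> t" "t \<le> 1" for t
    using admissible_convex_in_weights[OF V W that] by (simp only: seg)
  have pos: "\<And>k. 0 \<le> V $ k" "\<And>k. 0 \<le> W $ k"
    using V W by (auto simp: admissible_def)
  have "total_cost c ((1 - t) *\<^sub>R (V, Y) + t *\<^sub>R (W, Y))
      = ennreal (1 - t) * total_cost c (V, Y) + ennreal t * total_cost c (W, Y)"
    if "t \<in> {0..1}" for t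
    using total_cost_affine_in_weights[OF pos, of t c Y] that by (simp only: seg) simp
  then show "mono_on {0..1} (\<lambda>t. total_cost c ((1 - t) *\<^sub>R (V, Y) + t *\<^sub>R (W, Y)))"
    using mono_on_ennreal_segment[OF le] by (simp add: monotone_on_def)
qed

lemma ascends_move_unused_points:
  assumes Y: "(W, Y) \<in> admissible \<mu> \<phi> \<theta> A" and eq: "\<And>k. W $ k \<noteq> 0 \<Longrightarrow> Y $ k = Y' $ k"
  shows "ascends (total_cost c) (admissible \<mu> \<phi> \<theta> A) (W, Y) (W, Y')"
proof (rule ascends_segment)
  define Z where "Z t = (1 - t) *\<^sub>R Y + t *\<^sub>R Y'" for t :: real
  have seg: "(1 - t) *\<^sub>R (W, Y) + t *\<^sub>R (W, Y') = (W, Z t)" for t :: real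
    by (simp add: prod_eq_iff Z_def flip: scaleR_add_left)
  have Z: "Y $ k = Z t $ k" if "W $ k \<noteq> 0" for t k
    using eq[OF that] by (simp add: Z_def flip: scaleR_add_left)
  show "(1 - t) *\<^sub>R (W, Y) + t *\<^sub>R (W, Y') \<in> admissible \<mu> \<phi> \<theta> A" for t
    using Y admissible_eq_on_support[of W Y "Z t", OF Z] by (subst seg) blast
  have "total_cost c (W, Z t) = total_cost c (W, Y)" for t
    using total_cost_eq_on_support[of W Y "Z t", OF Z] by simp
  then show "mono_on {0..1} (\<lambda>t. total_cost c ((1 - t) *\<^sub>R (W, Y) + t *\<^sub>R (W, Y')))"
    by (simp only: seg) (simp add: monotone_on_def)
qed

section \<open>Concentrating the weights on few atoms\<close>

text \<open>Caratheodory's theorem speaks of a set of points, whereas here the points form a family in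
  which a point may be repeated. Choosing one index for each point of the small simplex carries it
  over to families.\<close>

lemma caratheodory_weights:
  fixes w :: "'k::finite \<Rightarrow> real" and v :: "'k \<Rightarrow> 'a::euclidean_space"
  assumes w: "\<And>k. 0 \<le> w k" "(\<Sum>k\<in>UNIV. w k) = 1"
  obtains u where "\<And>k. 0 \<le> u k" "(\<Sum>k\<in>UNIV. u k) = 1"
    "(\<Sum>k\<in>UNIV. u k *\<^sub>R v k) = (\<Sum>k\<in>UNIV. w k *\<^sub>R v k)"
    "\<And>k. w k = 0 \<Longrightarrow> u k = 0" "card {k. u k \<noteq> 0} \<le> DIM('a) + 1"
proof -
  define S where "S = {k. w k \<noteq> 0}"
  have off: "w k = 0" if "k \<in> UNIV - S" for k
    using that by (simp add: S_def)
  have "(\<Sum>k\<in>S. w k) = (\<Sum>k\<in>UNIV. w k)"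
    by (rule sum.mono_neutral_left) (auto simp: off)
  moreover have "(\<Sum>k\<in>S. w k *\<^sub>R v k) = (\<Sum>k\<in>UNIV. w k *\<^sub>R v k)"
    by (rule sum.mono_neutral_left) (auto simp: off)
  ultimately have "(\<Sum>k\<in>UNIV. w k *\<^sub>R v k) \<in> convex hull (v ` S)"
    using convex_sum[of S "convex hull (v ` S)" w v] w by (auto simp: hull_inc)
  then obtain T a where T: "finite T" "T \<subseteq> v ` S" "card T \<le> DIM('a) + 1"
    and a: "\<And>x. x \<in> T \<Longrightarrow> 0 \<le> a x" "sum a T = 1" "(\<Sum>x\<in>T. a x *\<^sub>R x) = (\<Sum>k\<in>UNIV. w k *\<^sub>R v k)"
    unfolding convex_hull_caratheodory[of "v ` S"] by blast
  \<comment> \<open>One index for each vertex of the simplex.\<close>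
  obtain R where R: "R \<subseteq> S" "inj_on v R" "T = v ` R"
    using T(2) by (meson subset_image_inj)
  define u where "u k = (if k \<in> R then a (v k) else 0)" for k
  show thesis
  proof
    show "0 \<le> u k" for k
      using a R by (auto simp: u_def)
    show "(\<Sum>k\<in>UNIV. u k) = 1"
      using a(2) R by (simp add: u_def sum.If_cases sum.reindex)
    have "(\<Sum>k\<in>UNIV. u k *\<^sub>R v k) = (\<Sum>k\<in>R. a (v k) *\<^sub>R v k)"
      unfolding u_def by (rule sum.mono_neutral_cong_right) auto
    then show "(\<Sum>k\<in>UNIV. u k *\<^sub>R v k) = (\<Sum>k\<in>UNIV. w k *\<^sub>R v k)"
      using a(3) R by (simp add: sum.reindex)
    show "u k = 0" if "w k = 0" for k
      using that R by (auto simp: u_def S_def)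
    have "card {k. u k \<noteq> 0} \<le> card R"
      by (intro card_mono) (auto simp: u_def)
    also have "\<dots> = card T"
      using R by (simp add: card_image)
    finally show "card {k. u k \<noteq> 0} \<le> DIM('a) + 1"
      using T by simp
  qed
qed

text \<open>Caratheodory's theorem needs a real coordinate that keeps track of the cost, but single atoms may
  have infinite cost. If the total cost is finite, then the atoms of positive weight have finite
  cost and the real values of the costs will do. If it is infinite, this means that the
  atoms of infinite cost carry positive mass, and it is enough to preserve that mass.\<close>

lemma total_cost_determined_by_real_functional:
  obtains g :: "'k::finite \<Rightarrow> real" where
    "\<And>V :: real ^ 'k. \<lbrakk>\<And>k. 0 \<le> V $ k; \<And>k. W $ k = 0 \<Longrightarrow> V $ k = 0;
       (\<Sum>k\<in>UNIV. V $ k * g k) = (\<Sum>k\<in>UNIV. W $ k * g k); \<And>k. 0 \<le> W $ k\<rbrakk>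
     \<Longrightarrow> total_cost c (V, Y) = total_cost c (W, Y)"
proof (cases "total_cost c (W, Y) = \<infinity>")
  case True
  define g :: "'k \<Rightarrow> real" where "g k = (if c (Y $ k) = \<infinity> then 1 else 0)" for k
  have inf_iff: "total_cost c (V, Y) = \<infinity> \<longleftrightarrow> (\<Sum>k\<in>UNIV. V $ k * g k) \<noteq> 0"
    if V: "\<And>k. 0 \<le> V $ k" for V :: "real ^ 'k"
  proof -
    have "total_cost c (V, Y) = \<infinity> \<longleftrightarrow> (\<exists>k. V $ k * g k \<noteq> 0)"
      using V by (auto simp: total_cost_def g_def ennreal_mult_eq_top_iff order_le_less)
    also have "\<dots> \<longleftrightarrow> (\<Sum>k\<in>UNIV. V $ k * g k) \<noteq> 0"
      using V by (subst sum_nonneg_eq_0_iff) (auto simp: g_def)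
    finally show ?thesis .
  qed
  show thesis
    by (rule that[of g]) (metis True inf_iff)
next
  case False
  define g where "g k = enn2real (c (Y $ k))" for k
  have cost: "total_cost c (V, Y) = ennreal (\<Sum>k\<in>UNIV. V $ k * g k)"
    if V: "\<And>k. 0 \<le> V $ k" and W: "\<And>k. 0 \<le> W $ k" and supp: "\<And>k. W $ k = 0 \<Longrightarrow> V $ k = 0"
    for V
  proof -
    have "ennreal (V $ k) * c (Y $ k) = ennreal (V $ k * g k)" for k
    proof (cases "V $ k = 0")
      case False
      then have "W $ k > 0"
        using W[of k] supp[of k] by (auto simp: order_le_less)
      then have "c (Y $ k) \<noteq> \<infinity>"
        using \<open>total_cost c (W, Y) \<noteq> \<infinity>\<close> by (auto simp: total_cost_def ennreal_mult_eq_top_iff)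
      then show ?thesis
        using V[of k] by (simp add: g_def ennreal_mult less_top)
    qed simp
    then show ?thesis
      using V by (simp add: total_cost_def g_def)
  qed
  show thesis
    by (rule that[of g]) (simp add: cost)
qed

text \<open>Each atom is sent to its \<open>\<theta>\<close>-moment, its cost coordinate and its \<open>N\<close> test moments, hence to a
  point of a space of dimension \<open>N + 2\<close>. The weights form a convex combination of these points, so
  \<open>N + 3\<close> atoms suffice for the same barycentre.\<close>

lemma admissible_sparse_weights:
  fixes \<phi> :: "'n::finite \<Rightarrow> real ^ 'd \<Rightarrow> real" and W :: "real ^ 'k"
  assumes adm: "(W, Y) \<in> admissible \<mu> \<phi> \<theta> A"
  obtains V where "(V, Y) \<in> admissible \<mu> \<phi> \<theta> A" "total_cost c (V, Y) = total_cost c (W, Y)"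
    "card {k. V $ k \<noteq> 0} \<le> CARD('n) + 3"
proof -
  obtain g :: "'k \<Rightarrow> real" where g:
    "\<And>V. \<lbrakk>\<And>k. 0 \<le> V $ k; \<And>k. W $ k = 0 \<Longrightarrow> V $ k = 0;
       (\<Sum>k\<in>UNIV. V $ k * g k) = (\<Sum>k\<in>UNIV. W $ k * g k); \<And>k. 0 \<le> W $ k\<rbrakk>
     \<Longrightarrow> total_cost c (V, Y) = total_cost c (W, Y)"
    using total_cost_determined_by_real_functional[of W c Y] by blast
  define v :: "'k \<Rightarrow> real \<times> real \<times> (real ^ 'n)" where
    "v k = (coord_avg (\<lambda>x. \<theta> (norm x)) (Y $ k), g k, \<chi> n. coord_avg (\<phi> n) (Y $ k))" for k
  have W: "\<And>k. 0 \<le> W $ k" "(\<Sum>k\<in>UNIV. W $ k) = 1"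
    using adm by (auto simp: admissible_def)
  obtain u where u: "\<And>k. 0 \<le> u k" "(\<Sum>k\<in>UNIV. u k) = 1"
    "(\<Sum>k\<in>UNIV. u k *\<^sub>R v k) = (\<Sum>k\<in>UNIV. W $ k *\<^sub>R v k)"
    "\<And>k. W $ k = 0 \<Longrightarrow> u k = 0" "card {k. u k \<noteq> 0} \<le> DIM(real \<times> real \<times> (real ^ 'n)) + 1"
    using caratheodory_weights[of "\<lambda>k. W $ k" v] W by blast
  define V :: "real ^ 'k" where "V = (\<chi> k. u k)"
  have V: "V $ k = u k" for k
    by (simp add: V_def)
  have eq\<theta>: "(\<Sum>k\<in>UNIV. V $ k * coord_avg (\<lambda>x. \<theta> (norm x)) (Y $ k))
      = (\<Sum>k\<in>UNIV. W $ k * coord_avg (\<lambda>x. \<theta> (norm x)) (Y $ k))"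
    using arg_cong[OF u(3), of fst] by (simp add: fst_sum v_def V)
  have eqg: "(\<Sum>k\<in>UNIV. V $ k * g k) = (\<Sum>k\<in>UNIV. W $ k * g k)"
    using arg_cong[OF u(3), of "\<lambda>z. fst (snd z)"] by (simp add: fst_sum snd_sum v_def V)
  have eq\<phi>: "(\<Sum>k\<in>UNIV. V $ k * coord_avg (\<phi> n) (Y $ k))
      = (\<Sum>k\<in>UNIV. W $ k * coord_avg (\<phi> n) (Y $ k))" for n
    using arg_cong[OF u(3), of "\<lambda>z. snd (snd z) $ n"] by (simp add: snd_sum v_def V)
  show thesis
  proof
    show "(V, Y) \<in> admissible \<mu> \<phi> \<theta> A"
      using adm u(1,2) unfolding admissible_def by (simp add: eq\<theta> eq\<phi>) (simp add: V)
    show "total_cost c (V, Y) = total_cost c (W, Y)"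
      using u(1,4) eqg W by (intro g) (auto simp: V)
    show "card {k. V $ k \<noteq> 0} \<le> CARD('n) + 3"
      using u(5) by (simp add: V)
  qed
qed

section \<open>Moving mass between sparse configurations\<close>

text \<open>The involution exchanges the slots in \<open>S \<inter> T\<close> with slots outside \<open>S \<union> T\<close> and fixes the others, so
  that \<open>\<pi> ` T\<close> avoids \<open>S\<close>. There is room for this because the bound on the cardinalities
  amounts to \<open>card (S \<inter> T) \<le> CARD('k) - card (S \<union> T)\<close>. The last property says that \<open>\<pi>\<close> moves no
  slot of \<open>T\<close> to a different slot of \<open>T\<close>: this allows the configuration on \<open>\<pi> ` T\<close> and the one on
  \<open>T\<close> to be held by the same family of positions.\<close>

lemma separating_involution:
  fixes S T :: "'k::finite set"
  assumes "card S + card T \<le> CARD('k)"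
  obtains \<pi> where "\<And>k. \<pi> (\<pi> k) = k" "\<And>k. \<pi> k \<in> T \<Longrightarrow> k \<notin> S"
    "\<And>k. \<lbrakk>k \<in> T; \<pi> k \<in> T\<rbrakk> \<Longrightarrow> \<pi> k = k"
proof -
  have "card (S \<inter> T) + card (S \<union> T) \<le> CARD('k)"
    using assms card_Un_Int[of S T] by simp
  moreover have "card (- (S \<union> T)) = CARD('k) - card (S \<union> T)"
    by (simp add: Compl_eq_Diff_UNIV card_Diff_subset)
  ultimately have "card (S \<inter> T) \<le> card (- (S \<union> T))"
    by simp
  then obtain h where h: "inj_on h (S \<inter> T)" "h ` (S \<inter> T) \<subseteq> - (S \<union> T)"
    using card_le_inj[of "S \<inter> T" "- (S \<union> T)"] by auto
  define \<pi> where "\<pi> k = (if k \<in> S \<inter> T then h k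
      else if k \<in> h ` (S \<inter> T) then inv_into (S \<inter> T) h k else k)" for k
  have 1: "\<pi> k = h k" "h k \<notin> S" "h k \<notin> T" "\<pi> (h k) = k" if "k \<in> S \<inter> T" for k
    using that h by (auto simp: \<pi>_def image_subset_iff)
  have 3: "\<pi> k = k" if "k \<notin> S \<inter> T" "k \<notin> h ` (S \<inter> T)" for k
    using that by (auto simp: \<pi>_def)
  show thesis
  proof
    fix k
    consider "k \<in> S \<inter> T" | j where "k = h j" "j \<in> S \<inter> T" | "k \<notin> S \<inter> T" "k \<notin> h ` (S \<inter> T)"
      by blast
    note cs = this
    show "\<pi> (\<pi> k) = k"
      using cs by cases (simp_all add: 1 3)
    show "k \<notin> S" if "\<pi> k \<in> T"
      using cs by cases (use that 1 3 in auto)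
    show "\<pi> k = k" if "k \<in> T" "\<pi> k \<in> T"
      using cs by cases (use that 1 3 in auto)
  qed
qed

lemma relabel_config:
  fixes V :: "real ^ 'k" and Y :: "((real ^ 'd) ^ 'm) ^ 'k"
  assumes "bij \<pi>"
  shows "(\<chi> k. V $ \<pi> k, \<chi> k. Y $ \<pi> k) \<in> admissible \<mu> \<phi> \<theta> A \<longleftrightarrow> (V, Y) \<in> admissible \<mu> \<phi> \<theta> A"
    and "total_cost c (\<chi> k. V $ \<pi> k, \<chi> k. Y $ \<pi> k) = total_cost c (V, Y)"
proof -
  have re: "(\<Sum>k\<in>UNIV. F (\<pi> k)) = (\<Sum>k\<in>UNIV. F k)" for F :: "'k \<Rightarrow> 'z::comm_monoid_add"
    using sum.reindex_bij_betw[OF assms] by simp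
  have "(\<forall>k. 0 \<le> V $ \<pi> k) \<longleftrightarrow> (\<forall>k. 0 \<le> V $ k)"
    using assms by (metis bij_pointE)
  then show "(\<chi> k. V $ \<pi> k, \<chi> k. Y $ \<pi> k) \<in> admissible \<mu> \<phi> \<theta> A \<longleftrightarrow> (V, Y) \<in> admissible \<mu> \<phi> \<theta> A"
    using re[of "\<lambda>k. V $ k"] re[of "\<lambda>k. V $ k * coord_avg (\<lambda>x. \<theta> (norm x)) (Y $ k)"]
      re[of "\<lambda>k. V $ k * coord_avg (\<phi> _) (Y $ k)"]
    by (simp add: admissible_def)
  show "total_cost c (\<chi> k. V $ \<pi> k, \<chi> k. Y $ \<pi> k) = total_cost c (V, Y)"
    using re[of "\<lambda>k. ennreal (V $ k) * c (Y $ k)"] by (simp add: total_cost_def)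
qed

text \<open>Let \<open>V\<close> and \<open>Y\<close> be the second configuration, relabelled so that its support avoids that of \<open>V0\<close>. The
  family \<open>Ya\<close> holds the atoms of both \<open>(V0, Y0)\<close> and \<open>(V, Y)\<close>, and \<open>Yb\<close> holds the atoms of both \<open>(V, Y)\<close>
  and \<open>(V1, Y1)\<close>. The chain is
  \<open>(V0, Y0) \<rightarrow> (V0, Ya) \<rightarrow> (V, Ya) \<rightarrow> (V, Yb) \<rightarrow> (V1, Yb) \<rightarrow> (V1, Y1)\<close>,
  and relabelling does not change the cost, so the cost changes in the second step only.\<close>

lemma ascends_sparse:
  fixes V0 V1 :: "real ^ 'k" and Y0 Y1 :: "((real ^ 'd) ^ 'm) ^ 'k"
  assumes adm0: "(V0, Y0) \<in> admissible \<mu> \<phi> \<theta> A" and adm1: "(V1, Y1) \<in> admissible \<mu> \<phi> \<theta> A"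
    and card: "card {k. V0 $ k \<noteq> 0} + card {k. V1 $ k \<noteq> 0} \<le> CARD('k)"
    and le: "total_cost c (V0, Y0) \<le> total_cost c (V1, Y1)"
  shows "ascends (total_cost c) (admissible \<mu> \<phi> \<theta> A) (V0, Y0) (V1, Y1)"
proof -
  let ?U = "admissible \<mu> \<phi> \<theta> A"
  obtain \<pi> where inv: "\<And>k. \<pi> (\<pi> k) = k"
    and sep': "\<And>k. \<pi> k \<in> {k. V1 $ k \<noteq> 0} \<Longrightarrow> k \<notin> {k. V0 $ k \<noteq> 0}"
    and stay': "\<And>k. \<lbrakk>k \<in> {k. V1 $ k \<noteq> 0}; \<pi> k \<in> {k. V1 $ k \<noteq> 0}\<rbrakk> \<Longrightarrow> \<pi> k = k"
    using separating_involution[OF card] by blast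
  have sep: "V0 $ k = 0" if "V1 $ \<pi> k \<noteq> 0" for k
    using sep'[of k] that by simp
  have stay: "\<pi> k = k" if "V1 $ k \<noteq> 0" "V1 $ \<pi> k \<noteq> 0" for k
    using stay'[of k] that by simp
  have bij: "bij \<pi>"
    using inv by (rule involuntory_imp_bij)
  define V where "V = (\<chi> k. V1 $ \<pi> k)"
  define Y where "Y = (\<chi> k. Y1 $ \<pi> k)"
  define Ya where "Ya = (\<chi> k. if V0 $ k \<noteq> 0 then Y0 $ k else Y1 $ \<pi> k)"
  define Yb where "Yb = (\<chi> k. if V1 $ \<pi> k \<noteq> 0 then Y1 $ \<pi> k else Y1 $ k)"
  have VY: "(V, Y) \<in> ?U" "total_cost c (V, Y) = total_cost c (V1, Y1)"
    using adm1 relabel_config(1)[OF bij, of V1 Y1] relabel_config(2)[OF bij, of c V1 Y1]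
    unfolding V_def Y_def by blast+
  have a0: "Y0 $ k = Ya $ k" if "V0 $ k \<noteq> 0" for k
    using that by (simp add: Ya_def)
  have a: "Y $ k = Ya $ k" if "V $ k \<noteq> 0" for k
    using that sep by (simp add: Ya_def Y_def V_def)
  have b: "Y $ k = Yb $ k" if "V $ k \<noteq> 0" for k
    using that by (simp add: Yb_def Y_def V_def)
  have ab: "Ya $ k = Yb $ k" if "V $ k \<noteq> 0" for k
    using a b that by metis
  have b1: "Yb $ k = Y1 $ k" if "V1 $ k \<noteq> 0" for k
    using that stay[of k] by (auto simp: Yb_def)
  note cost = total_cost_eq_on_support[of V0 Y0 Ya c, OF a0] total_cost_eq_on_support[of V Y Ya c, OF a]
    total_cost_eq_on_support[of V Y Yb c, OF b] total_cost_eq_on_support[of V1 Yb Y1 c, OF b1]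
  have V0a: "(V0, Ya) \<in> ?U" using adm0 admissible_eq_on_support[OF a0] by blast
  have Va: "(V, Ya) \<in> ?U" using VY admissible_eq_on_support[OF a] by blast
  have Vb: "(V, Yb) \<in> ?U" using VY admissible_eq_on_support[OF b] by blast
  have V1b: "(V1, Yb) \<in> ?U" using adm1 admissible_eq_on_support[OF b1] by blast
  have "ascends (total_cost c) ?U (V0, Y0) (V0, Ya)"
    using adm0 a0 by (rule ascends_move_unused_points)
  also have "ascends (total_cost c) ?U (V0, Ya) (V, Ya)"
    using V0a Va le VY cost by (intro ascends_change_weights) auto
  also have "ascends (total_cost c) ?U (V, Ya) (V, Yb)"
    using Va ab by (rule ascends_move_unused_points)
  also have "ascends (total_cost c) ?U (V, Yb) (V1, Yb)"
    using Vb V1b VY cost by (intro ascends_change_weights) auto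
  also have "ascends (total_cost c) ?U (V1, Yb) (V1, Y1)"
    using V1b b1 by (rule ascends_move_unused_points)
  finally show ?thesis .
qed

lemma ascends_admissible:
  fixes \<phi> :: "'n::finite \<Rightarrow> real ^ 'd \<Rightarrow> real"
    and W0 W1 :: "real ^ 'k" and Y0 Y1 :: "((real ^ 'd) ^ 'm) ^ 'k"
  assumes card: "2 * CARD('n) + 6 \<le> CARD('k)"
    and adm0: "(W0, Y0) \<in> admissible \<mu> \<phi> \<theta> A" and adm1: "(W1, Y1) \<in> admissible \<mu> \<phi> \<theta> A"
    and le: "total_cost c (W0, Y0) \<le> total_cost c (W1, Y1)"
  shows "ascends (total_cost c) (admissible \<mu> \<phi> \<theta> A) (W0, Y0) (W1, Y1)"
proof -
  let ?U = "admissible \<mu> \<phi> \<theta> A"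
  obtain V0 where V0: "(V0, Y0) \<in> ?U" "total_cost c (V0, Y0) = total_cost c (W0, Y0)"
      "card {k. V0 $ k \<noteq> 0} \<le> CARD('n) + 3"
    using admissible_sparse_weights[OF adm0] by blast
  obtain V1 where V1: "(V1, Y1) \<in> ?U" "total_cost c (V1, Y1) = total_cost c (W1, Y1)"
      "card {k. V1 $ k \<noteq> 0} \<le> CARD('n) + 3"
    using admissible_sparse_weights[OF adm1] by blast
  have "ascends (total_cost c) ?U (W0, Y0) (V0, Y0)"
    using adm0 V0 by (intro ascends_change_weights) auto
  also have "ascends (total_cost c) ?U (V0, Y0) (V1, Y1)"
    using V0 V1 le card by (intro ascends_sparse) auto
  also have "ascends (total_cost c) ?U (V1, Y1) (W1, Y1)"
    using adm1 V1 by (intro ascends_change_weights) auto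
  finally show ?thesis .
qed

theorem theorem1:
  fixes \<mu> :: "(real ^ 'd) measure"
    and c :: "(real ^ 'd) ^ 'm \<Rightarrow> ennreal"
    and \<phi> :: "'n::finite \<Rightarrow> real ^ 'd \<Rightarrow> real"
    and \<theta> :: "real \<Rightarrow> real"
    and A C s :: real
    and W0 W1 :: "real ^ 'k"
    and Y0 Y1 :: "((real ^ 'd) ^ 'm) ^ 'k"
  assumes "prob_space \<mu>" and "sets \<mu> = sets borel"
    and "lsc c" and "symmetric_cost c"
    and "\<And>n. continuous_on UNIV (\<phi> n)" and "\<And>n. integrable \<mu> (\<phi> n)"
    and "\<And>r. 0 \<le> r \<Longrightarrow> 0 \<le> \<theta> r" and "mono_on {0..} \<theta>" and "continuous_on {0..} \<theta>"
    and "filterlim \<theta> at_top at_top"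
    and "C > 0" and "0 < s" and "s < 1"
    and "\<And>n x. \<bar>\<phi> n x\<bar> \<le> C * (1 + \<theta> (norm x)) powr s"
    and "A > 0" and "(\<integral>\<^sup>+ x. ennreal (\<theta> (norm x)) \<partial>\<mu>) \<le> ennreal A"
    and "CARD('k) \<ge> 2 * CARD('n) + 6"
    and "(W0, Y0) \<in> admissible \<mu> \<phi> \<theta> A" and "(W1, Y1) \<in> admissible \<mu> \<phi> \<theta> A"
  shows "\<exists>\<psi> :: real \<Rightarrow> (real ^ 'k) \<times> (((real ^ 'd) ^ 'm) ^ 'k).
    \<psi> ` {0..1} \<subseteq> admissible \<mu> \<phi> \<theta> A \<and> polygonal_chain \<psi> \<and>
    \<psi> 0 = (W0, Y0) \<and> \<psi> 1 = (W1, Y1) \<and>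
    (mono_on {0..1} (\<lambda>t. total_cost c (\<psi> t)) \<or> antimono_on {0..1} (\<lambda>t. total_cost c (\<psi> t)))"
proof (cases "total_cost c (W0, Y0) \<le> total_cost c (W1, Y1)")
  case True
  then have "ascends (total_cost c) (admissible \<mu> \<phi> \<theta> A) (W0, Y0) (W1, Y1)"
    using assms by (intro ascends_admissible) auto
  then show ?thesis
    unfolding ascends_def by blast
next
  case False
  then have "ascends (total_cost c) (admissible \<mu> \<phi> \<theta> A) (W1, Y1) (W0, Y0)"
    using assms by (intro ascends_admissible) auto
  from ascends_reverse[OF this] show ?thesis
    by blast
qed

end
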